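(* There exists a tetrahedron $\Delta\subset\mathbb{R}^3$ (not a lattice polytope) that is hollow with respect to $\mathbb{Z}^3$ and whose lattice width with respect to $\mathbb{Z}^3$ equals $2+\sqrt2$.
   Context: A convex body $K\subset\mathbb{R}^d$ is hollow with respect to a lattice $\Lambda\cong\mathbb{Z}^d$ if its interior contains no point of $\Lambda$. The width of $K$ with respect to a linear functional $f$ is the length of the segment $f(K)$; the lattice width of $K$ is $\operatorname{width}_\Lambda(K)=\inf_{f\in\Lambda^*\setminus\{0\}}\operatorname{width}(K,f)$, where $\Lambda^*$ is the dual lattice. *)

theory Defs
  imports "HOL-Analysis.Analysis"
begin

text \<open>
  Lattices are represented by their sets of points, and the dual lattice by the linear functionals
  on the ambient space that take integer values on the lattice.
\<close>

definition integer_lattice :: "(real ^ 'n) set" where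
  "integer_lattice = {x. \<forall>i. x $ i \<in> \<int>}"

definition dual_lattice :: "'a::real_vector set \<Rightarrow> ('a \<Rightarrow> real) set" where
  "dual_lattice L = {f. linear f \<and> (\<forall>x\<in>L. f x \<in> \<int>)}"

definition hollow :: "'a::topological_space set \<Rightarrow> 'a set \<Rightarrow> bool" where
  "hollow L K \<longleftrightarrow> interior K \<inter> L = {}"

text \<open>
  The suprema and infima below are taken in the reals, so these two notions are meaningful for
  nonempty bounded sets \<open>K\<close>, in particular for convex bodies.
\<close>

definition functional_width :: "'a set \<Rightarrow> ('a \<Rightarrow> real) \<Rightarrow> real" where
  "functional_width K f = Sup (f ` K) - Inf (f ` K)"

definition lattice_width :: "'a::real_vector set \<Rightarrow> 'a set \<Rightarrow> real" where
  "lattice_width L K = (INF f \<in> dual_lattice L - {\<lambda>x. 0}. functional_width K f)"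

definition lattice_polytope :: "'a::real_vector set \<Rightarrow> 'a set \<Rightarrow> bool" where
  "lattice_polytope L P \<longleftrightarrow> (\<exists>V. finite V \<and> V \<subseteq> L \<and> P = convex hull V)"

end

theory Submission
  imports Defs
begin

text \<open>
  The tetrahedron is invariant under a cyclic symmetry of order four. Let \<open>p\<^sub>0, \<dots>, p\<^sub>3\<close> be the vertices
  of the standard simplex, so that lattice points are the integer quadruples \<open>(x\<^sub>0, \<dots>, x\<^sub>3)\<close> with
  sum \<open>1\<close>, and let the four facets be given by the cyclic shifts of
  \<open>x\<^sub>1 + \<surd>2 x\<^sub>2 + (3 - \<surd>2) x\<^sub>3 \<ge> 0\<close>, so that each facet contains one of the \<open>p\<^sub>i\<close> in its relative
  interior. The vertices are the cyclic shifts of \<open>(-3t, t, t, 1 + t)\<close> with \<open>t = (1 + \<surd>2)/4\<close>.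
  In \<open>\<real>\<^sup>3\<close> the coordinate \<open>x\<^sub>0 = 1 - x\<^sub>1 - x\<^sub>2 - x\<^sub>3\<close> is dropped.
  The coordinates on the tetrahedron lie strictly between \<open>-2\<close> and \<open>2\<close>, so only finitely many
  lattice points have to be excluded from the interior. An integer functional of
  width less than \<open>2 + \<surd>2\<close> has bounded coefficients as well, which leaves finitely many
  functionals.
\<close>

section \<open>Halfspaces, widths and functionals\<close>

lemma extreme_points_lattice_polytope:
  assumes "lattice_polytope L P" "x extreme_point_of P"
  shows "x \<in> L"
  using assms extreme_point_of_convex_hull unfolding lattice_polytope_def by blast

lemma interior_hull_gt_halfspace:
  fixes a :: "'a::euclidean_space"
  assumes "x \<in> interior (convex hull S)" "\<And>v. v \<in> S \<Longrightarrow> a \<bullet> v \<ge> b" "a \<noteq> 0"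
  shows "a \<bullet> x > b"
proof -
  have "convex hull S \<subseteq> {y. a \<bullet> y \<ge> b}"
    using assms(2) by (intro hull_minimal) (auto simp: convex_halfspace_ge)
  then have "x \<in> interior {y. a \<bullet> y \<ge> b}"
    using assms(1) interior_mono by blast
  then show ?thesis
    using assms(3) by (simp add: interior_halfspace_ge)
qed

lemma functional_width_ge:
  fixes f :: "'a::euclidean_space \<Rightarrow> real"
  assumes "linear f" "bounded K" "p \<in> K" "q \<in> K"
  shows "functional_width K f \<ge> f p - f q"
proof -
  have "bounded (f ` K)"
    using assms by (intro bounded_linear_image) (auto simp: linear_conv_bounded_linear)
  then have "f p \<le> Sup (f ` K)" "Inf (f ` K) \<le> f q"
    using assms by (auto intro!: cSup_upper cInf_lower bounded_imp_bdd_above bounded_imp_bdd_below)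
  then show ?thesis
    by (simp add: functional_width_def)
qed

lemma functional_width_hull_le:
  assumes "linear f" "S \<noteq> {}" "\<And>v. v \<in> S \<Longrightarrow> f v \<in> {l..u}"
  shows "functional_width (convex hull S) f \<le> u - l"
proof -
  have "f ` (convex hull S) \<subseteq> {l..u}"
    unfolding convex_hull_linear_image[OF assms(1)]
    using assms(3) by (intro hull_minimal) auto
  moreover have "f ` (convex hull S) \<noteq> {}"
    using assms(2) by simp
  ultimately have "Sup (f ` (convex hull S)) \<le> u" "Inf (f ` (convex hull S)) \<ge> l"
    by (auto intro!: cSup_least cInf_greatest)
  then show ?thesis
    by (simp add: functional_width_def)
qed

lemma linear_real3_eq:
  fixes f :: "real ^ 3 \<Rightarrow> real"
  assumes "linear f"
  shows "f x = f (axis 1 1) * x $ 1 + f (axis 2 1) * x $ 2 + f (axis 3 1) * x $ 3"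
proof -
  have "f x = f (\<Sum>i\<in>UNIV. x $ i *\<^sub>R axis i 1)"
    by (metis basis_expansion scalar_mult_eq_scaleR)
  also have "\<dots> = (\<Sum>i\<in>UNIV. x $ i * f (axis i 1))"
    using assms by (simp add: linear_sum linear_scale)
  finally show ?thesis
    by (simp add: sum_3 mult.commute)
qed

lemma axis_in_integer_lattice: "axis i 1 \<in> integer_lattice"
  by (auto simp: integer_lattice_def axis_def)

lemma component_in_dual_lattice: "(\<lambda>x. x $ i) \<in> dual_lattice integer_lattice"
  by (auto simp: dual_lattice_def integer_lattice_def linear_iff)

section \<open>The tetrahedron and its vertices\<close>

definition tet_param :: real where
  "tet_param = (1 + sqrt 2) / 4"

definition tet_vertices :: "(real ^ 3) set" where
  "tet_vertices = (let t = tet_param in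
     {vector [t, t, 1 + t], vector [-3 * t, t, t],
      vector [1 + t, -3 * t, t], vector [t, 1 + t, -3 * t]})"

text \<open>These rational bounds reduce the finite case checks below to linear arithmetic.\<close>

lemma sqrt2_bounds: "707 / 500 < sqrt 2" "sqrt 2 < 283 / 200"
  by (rule real_less_rsqrt real_less_lsqrt; simp add: power2_eq_square)+

lemma tet_param_bounds: "3 / 5 < tet_param" "tet_param < 121 / 200"
  using sqrt2_bounds by (auto simp: tet_param_def)

lemma distinct_tet_vertices:
  "distinct [vector [t, t, 1 + t], vector [-3 * t, t, t],
      vector [1 + t, -3 * t, t], vector [t, 1 + t, -3 * t] :: real ^ 3]" if "t > 0" for t :: real
  using that by (auto simp: vec_eq_iff forall_3)

lemma card_tet_vertices: "card tet_vertices = 4"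
  using distinct_card[OF distinct_tet_vertices[of tet_param]] tet_param_bounds
  by (simp add: tet_vertices_def Let_def)

lemma affine_independent_tet_vertices: "\<not> affine_dependent tet_vertices"
proof
  define t where "t = tet_param"
  have t: "t > 0"
    using tet_param_bounds by (simp add: t_def)
  define p q r s :: "real ^ 3" where
    "p = vector [t, t, 1 + t]" and "q = vector [-3 * t, t, t]" and
    "r = vector [1 + t, -3 * t, t]" and "s = vector [t, 1 + t, -3 * t]"
  have V: "tet_vertices = {p, q, r, s}"
    by (simp add: tet_vertices_def Let_def p_def q_def r_def s_def t_def)
  have d: "distinct [p, q, r, s]"
    using distinct_tet_vertices[OF t] by (simp add: p_def q_def r_def s_def)
  assume "affine_dependent tet_vertices"
  then obtain w where w: "w p + w q + w r + w s = 0"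
      "w p *\<^sub>R p + w q *\<^sub>R q + w r *\<^sub>R r + w s *\<^sub>R s = 0"
      "w p \<noteq> 0 \<or> w q \<noteq> 0 \<or> w r \<noteq> 0 \<or> w s \<noteq> 0"
    using d unfolding V by (auto simp: affine_dependent_explicit_finite add.assoc)
  have e: "w p * t + w q * (-3 * t) + w r * (1 + t) + w s * t = 0"
      "w p * t + w q * t + w r * (-3 * t) + w s * (1 + t) = 0"
      "w p * (1 + t) + w q * t + w r * t + w s * (-3 * t) = 0"
    using w(2) by (simp_all add: vec_eq_iff forall_3 p_def q_def r_def s_def)
  define u where "u = 4 * t"
  have u: "u > 0"
    using t by (simp add: u_def)
  have wp: "w p = - w q - w r - w s"
    using w(1) by linarith
  \<comment> \<open>Subtracting \<open>t\<close> times the zero sum of the weights from each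
    coordinate makes the weights a geometric progression with positive ratio \<open>u\<close>, so
    their sum vanishes only if all do.\<close>
  have 1: "w r = u * w q" "w s = u * w r" "w p = u * w s"
    using e unfolding wp u_def by (simp_all add: algebra_simps)
  then have "w q * (1 + u + u * u + u * u * u) = 0"
    using w(1) by (simp add: algebra_simps)
  moreover have "1 + u + u * u + u * u * u > 0"
    using u by (simp add: add_pos_pos)
  ultimately have "w q = 0"
    by simp
  then show False
    using 1 w(3) by simp
qed

lemma simplex_tet: "3 simplex (convex hull tet_vertices)"
  using affine_independent_tet_vertices card_tet_vertices
  by (auto simp: simplex_def)

lemma not_lattice_polytope_tet:
  "\<not> lattice_polytope integer_lattice (convex hull tet_vertices)"
proof
  define p :: "real ^ 3" where "p = vector [tet_param, tet_param, 1 + tet_param]"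
  have "p extreme_point_of (convex hull tet_vertices)"
    using affine_independent_tet_vertices
    by (simp add: extreme_point_of_convex_hull_affine_independent)
       (simp add: p_def tet_vertices_def Let_def)
  moreover assume "lattice_polytope integer_lattice (convex hull tet_vertices)"
  ultimately have "p \<in> integer_lattice"
    by (rule extreme_points_lattice_polytope[rotated])
  then have "p $ 1 \<in> \<int>"
    by (simp add: integer_lattice_def)
  then obtain n where "tet_param = of_int n"
    by (auto simp: p_def elim: Ints_cases)
  then have "0 < real_of_int n" "real_of_int n < 1"
    using tet_param_bounds by simp_all
  then show False
    by simp
qed

section \<open>Hollowness\<close>

lemma tet_component_bounds:
  assumes "x \<in> interior (convex hull tet_vertices)"
  shows "-2 < x $ i" "x $ i < 2"
proof -
  have "v $ i \<ge> -2 \<and> v $ i \<le> 2" if "v \<in> tet_vertices" for v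
    using that tet_param_bounds exhaust_3[of i] by (auto simp: tet_vertices_def Let_def)
  then show "-2 < x $ i" "x $ i < 2"
    using interior_hull_gt_halfspace[OF assms, of "-2" "axis i 1"]
      interior_hull_gt_halfspace[OF assms, of "-2" "- axis i 1"]
    by (auto simp: inner_axis' axis_eq_0_iff)
qed

text \<open>Each linear form vanishes at three vertices and equals 4 at the fourth; interior points
  satisfy the inequality strictly.\<close>

lemma tet_facet_ineqs:
  assumes "x \<in> interior (convex hull tet_vertices)"
  defines "s \<equiv> sqrt 2" and "y \<equiv> 1 - x $ 1 - x $ 2 - x $ 3"
  shows "x $ 1 + s * x $ 2 + (3 - s) * x $ 3 > 0"
    "x $ 2 + s * x $ 3 + (3 - s) * y > 0"
    "x $ 3 + s * y + (3 - s) * x $ 1 > 0"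
    "y + s * x $ 1 + (3 - s) * x $ 2 > 0"
proof -
  \<comment> \<open>The rules for \<open>s * s\<close> and \<open>s * tet_param\<close> make every
    vertex evaluation linear in \<open>s\<close>.\<close>
  have s: "s * s = 2" "s > 1" "s < 2" "4 * tet_param = 1 + s" "s * tet_param = 1 / 4 + tet_param"
    using sqrt2_bounds by (auto simp: s_def tet_param_def algebra_simps)
  have ineq: "a * x $ 1 + b * x $ 2 + c * x $ 3 > d"
    if "\<And>v. v \<in> tet_vertices \<Longrightarrow> a * v $ 1 + b * v $ 2 + c * v $ 3 \<ge> d" "a \<noteq> 0" for a b c d
    using that interior_hull_gt_halfspace[OF assms(1), where a = "vector [a, b, c]" and b = d]
    by (simp add: inner_vec_def sum_3 vec_eq_iff forall_3)
  have "1 * x $ 1 + s * x $ 2 + (3 - s) * x $ 3 > 0"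
    by (rule ineq) (use s in \<open>auto simp: tet_vertices_def Let_def algebra_simps add_divide_distrib\<close>)
  then show "x $ 1 + s * x $ 2 + (3 - s) * x $ 3 > 0"
    by simp
  \<comment> \<open>The remaining forms are rewritten by substituting \<open>y\<close> and moving
    the constant to the right.\<close>
  have "(s - 3) * x $ 1 + (s - 2) * x $ 2 + (2 * s - 3) * x $ 3 > s - 3"
    by (rule ineq) (use s in \<open>auto simp: tet_vertices_def Let_def algebra_simps add_divide_distrib\<close>)
  then show "x $ 2 + s * x $ 3 + (3 - s) * y > 0"
    by (simp add: y_def algebra_simps)
  have "3 - 2 * s \<noteq> 0"
    using sqrt2_bounds unfolding s_def by linarith
  then have "(3 - 2 * s) * x $ 1 + (- s) * x $ 2 + (1 - s) * x $ 3 > - s"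
    by (intro ineq) (use s in \<open>auto simp: tet_vertices_def Let_def algebra_simps add_divide_distrib\<close>)
  then show "x $ 3 + s * y + (3 - s) * x $ 1 > 0"
    by (simp add: y_def algebra_simps)
  have "(s - 1) * x $ 1 + (2 - s) * x $ 2 + (- 1) * x $ 3 > - 1"
    by (rule ineq) (use s in \<open>auto simp: tet_vertices_def Let_def algebra_simps add_divide_distrib\<close>)
  then show "y + s * x $ 1 + (3 - s) * x $ 2 > 0"
    by (simp add: y_def algebra_simps)
qed

lemma hollow_tet: "hollow integer_lattice (convex hull tet_vertices)"
proof -
  have False if x: "x \<in> interior (convex hull tet_vertices)" "x \<in> integer_lattice" for x :: "real ^ 3"
  proof -
    have int: "x $ i \<in> {-1, 0, 1}" for i
    proof -
      obtain n where n: "x $ i = of_int n"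
        using x(2) by (auto simp: integer_lattice_def elim: Ints_cases)
      then have "-2 < n" "n < 2"
        using tet_component_bounds[OF x(1), of i] by linarith+
      then have "n \<in> {-1, 0, 1}"
        by auto
      then show ?thesis
        using n by auto
    qed
    \<comment> \<open>Each of the 27 candidates violates a facet inequality. Strictness matters: the
      origin and the unit vectors lie on facets.\<close>
    show False
      using tet_facet_ineqs[OF x(1)] int[of 1] int[of 2] int[of 3] sqrt2_bounds
      by (elim insertE emptyE; simp; linarith?)
  qed
  then show ?thesis
    by (auto simp: hollow_def)
qed

section \<open>Lattice width\<close>

text \<open>
  Up to a common summand, \<open>c\<close>, \<open>- u a\<close>, \<open>a - u b\<close>, \<open>b - u c\<close> with \<open>u = 1 + \<surd>2\<close> are the values of the
  functional \<open>(a, b, c)\<close> at the four vertices.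
\<close>

lemma small_width_imp_zero:
  fixes a b c :: int and u :: real
  assumes u: "1207 / 500 < u" "u < 483 / 200"
    and w: "\<bar>c + u * a\<bar> < 1 + u" "\<bar>c - a + u * b\<bar> < 1 + u" "\<bar>c - b + u * c\<bar> < 1 + u"
      "\<bar>a - u * b + u * a\<bar> < 1 + u" "\<bar>b - u * c + u * a\<bar> < 1 + u"
      "\<bar>b - u * c - a + u * b\<bar> < 1 + u"
  shows "a = 0 \<and> b = 0 \<and> c = 0"
proof -
  \<comment> \<open>Replacing \<open>u\<close> by a rational lower bound leaves inequalities linear
    in the absolute values of the coefficients.\<close>
  have lb: "1207 / 500 * \<bar>z\<bar> \<le> \<bar>u * z\<bar>" for z :: real
    using mult_right_mono[of "1207 / 500" u "\<bar>z\<bar>"] u by (simp add: abs_mult)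
  have "1707 / 500 * \<bar>real_of_int c\<bar> \<le> \<bar>(1 + u) * c\<bar>"
    using mult_right_mono[of "1707 / 500" "1 + u" "\<bar>real_of_int c\<bar>"] u by (simp add: abs_mult)
  also have "(1 + u) * c = c + u * c"
    by (simp add: algebra_simps)
  finally have "1707 / 500 * \<bar>real_of_int c\<bar> \<le> \<bar>c + u * c\<bar>" .
  then have 3: "1707 / 500 * \<bar>real_of_int c\<bar> < 683 / 200 + \<bar>b\<bar>"
    using w(3) u unfolding of_int_diff of_int_abs by linarith
  have 1: "1207 / 500 * \<bar>real_of_int a\<bar> < 683 / 200 + \<bar>c\<bar>" and 2: "1207 / 500 * \<bar>real_of_int b\<bar> < 683 / 200 + \<bar>a\<bar> + \<bar>c\<bar>"
    using w(1,2) lb[of a] lb[of b] u unfolding of_int_diff of_int_abs by linarith+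
  \<comment> \<open>Eliminating \<open>a\<close> and \<open>c\<close> bounds \<open>b\<close>;
    rounding to integers then sharpens the bounds in turn, leaving 75 triples.\<close>
  have "\<bar>b\<bar> < 4"
    using 1 2 3 by linarith
  then have "\<bar>c\<bar> < 2"
    using 3 by linarith
  then have "\<bar>a\<bar> < 3"
    using 1 by linarith
  then have "\<bar>b\<bar> < 3"
    using 2 \<open>\<bar>c\<bar> < 2\<close> by linarith
  have "a \<in> {-2, -1, 0, 1, 2}" "b \<in> {-2, -1, 0, 1, 2}" "c \<in> {-1, 0, 1}"
    using \<open>\<bar>a\<bar> < 3\<close> \<open>\<bar>b\<bar> < 3\<close> \<open>\<bar>c\<bar> < 2\<close> by auto
  then show ?thesis
    using u w unfolding abs_less_iff by (elim insertE emptyE; simp; linarith?)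
qed

lemma lattice_width_tet: "lattice_width integer_lattice (convex hull tet_vertices) = 2 + sqrt 2"
proof -
  let ?K = "convex hull tet_vertices"
  let ?D = "dual_lattice integer_lattice - {\<lambda>x :: real ^ 3. 0}"
  have ge: "functional_width ?K f \<ge> 2 + sqrt 2" if f: "f \<in> ?D" for f
  proof (rule ccontr)
    assume *: "\<not> ?thesis"
    have lin: "linear f" and int: "\<And>i. f (axis i 1) \<in> \<int>"
      using f axis_in_integer_lattice by (auto simp: dual_lattice_def)
    obtain a b c where abc: "f (axis 1 1) = of_int a" "f (axis 2 1) = of_int b" "f (axis 3 1) = of_int c"
      using int by (metis Ints_cases)
    have fx: "f x = a * x $ 1 + b * x $ 2 + c * x $ 3" for x
      using linear_real3_eq[OF lin, of x] by (simp add: abc)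
    have "bounded ?K"
      by (simp add: tet_vertices_def Let_def finite_imp_bounded bounded_convex_hull)
    then have "f p - f q < 2 + sqrt 2" if "p \<in> tet_vertices" "q \<in> tet_vertices" for p q
      using * functional_width_ge[OF lin, of ?K p q] that by (simp add: hull_inc)
    then have d: "\<bar>f p - f q\<bar> < 2 + sqrt 2" if "p \<in> tet_vertices" "q \<in> tet_vertices" for p q
      using that by (simp add: abs_less_iff)
    define t where "t = tet_param"
    define u where "u = 4 * t"
    have u: "u = 1 + sqrt 2"
      by (simp add: u_def t_def tet_param_def)
    define p q r s :: "real ^ 3" where
      "p = vector [t, t, 1 + t]" and "q = vector [-3 * t, t, t]" and
      "r = vector [1 + t, -3 * t, t]" and "s = vector [t, 1 + t, -3 * t]"
    note pqrs = p_def q_def r_def s_def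
    have "p \<in> tet_vertices" "q \<in> tet_vertices" "r \<in> tet_vertices" "s \<in> tet_vertices"
      by (simp_all add: tet_vertices_def Let_def pqrs t_def)
    then have d: "\<bar>f p - f q\<bar> < 1 + u" "\<bar>f p - f r\<bar> < 1 + u" "\<bar>f p - f s\<bar> < 1 + u"
      "\<bar>f r - f q\<bar> < 1 + u" "\<bar>f s - f q\<bar> < 1 + u" "\<bar>f s - f r\<bar> < 1 + u"
      using d by (simp_all add: u)
    \<comment> \<open>The common summand \<open>t * (a + b + c)\<close> cancels in all
      differences.\<close>
    have "f p - f q = c + u * a" "f p - f r = c - a + u * b" "f p - f s = c - b + u * c"
      "f r - f q = a - u * b + u * a" "f s - f q = b - u * c + u * a"
      "f s - f r = b - u * c - a + u * b"
      unfolding fx pqrs u_def by (simp_all add: algebra_simps)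
    note small_width_imp_zero[OF _ _ d[unfolded this]]
    then have "a = 0 \<and> b = 0 \<and> c = 0"
      using sqrt2_bounds u by simp
    then have "f = (\<lambda>x. 0)"
      using fx by auto
    then show False
      using f by simp
  qed
  \<comment> \<open>The first coordinate attains the bound: its vertex values range from
    \<open>-3 * t\<close> to \<open>1 + t\<close>, and \<open>1 + 4 * t\<close> is 2 +
    \<open>sqrt 2\<close>.\<close>
  define g :: "real ^ 3 \<Rightarrow> real" where "g = (\<lambda>x. x $ 1)"
  have "g (axis 1 1) \<noteq> 0"
    by (simp add: g_def)
  then have "g \<noteq> (\<lambda>x. 0)"
    by metis
  then have g: "g \<in> ?D"
    using component_in_dual_lattice[of 1] by (simp add: g_def)
  have "functional_width ?K g \<le> (1 + tet_param) - (-3 * tet_param)"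
    using g tet_param_bounds
    by (intro functional_width_hull_le) (auto simp: dual_lattice_def tet_vertices_def Let_def g_def)
  then have "functional_width ?K g \<le> 2 + sqrt 2"
    by (simp add: tet_param_def field_simps)
  \<comment> \<open>Here \<open>ge\<close> also shows that the set of widths is bounded below, which
    the real infimum requires.\<close>
  moreover have "lattice_width integer_lattice ?K \<le> functional_width ?K g"
    unfolding lattice_width_def using ge g by (intro cINF_lower bdd_belowI2) auto
  moreover have "lattice_width integer_lattice ?K \<ge> 2 + sqrt 2"
    unfolding lattice_width_def using ge g by (intro cINF_greatest) auto
  ultimately show ?thesis
    by linarith
qed

theorem theorem1p1:
  shows "\<exists>\<Delta> :: (real ^ 3) set.
           3 simplex \<Delta> \<and>
           \<not> lattice_polytope integer_lattice \<Delta> \<and>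
           hollow integer_lattice \<Delta> \<and>
           lattice_width integer_lattice \<Delta> = 2 + sqrt 2"
  using simplex_tet not_lattice_polytope_tet hollow_tet lattice_width_tet by blast

end
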